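(* Let $n\ge 2$ and let $\mu$ be a positive Borel measure on $\mathbb{R}^n$ satisfying $\int_{\mathbb{R}^n}\prod_{\ell=1}^n\frac{1}{1+t_\ell^2}\,d\mu(\vec t)<\infty$. Then the following statements are equivalent. (a) $$\sum_{\substack{\vec\rho\in\{-1,0,1\}^n\\ -1\in\vec\rho\ \wedge\ 1\in\vec\rho}}\int_{\mathbb{R}^n}N_{\rho_1,1}N_{\rho_2,2}\cdots N_{\rho_n,n}\,d\mu(\vec t)=0$$ for all $\vec z\in(\mathbb{C}^+)^n$. (b) $$\int_{\mathbb{R}^n}N_{\rho_1,1}N_{\rho_2,2}\cdots N_{\rho_n,n}\,d\mu(\vec t)=0$$ for all $\vec z\in(\mathbb{C}^+)^n$ and for every vector $\vec\rho\in\{-1,0,1\}^n$ with at least one entry equal to $1$ and at least one entry equal to $-1$. (c) $$\int_{\mathbb{R}^n}\left(\frac{t_1-i}{t_1+i}\right)^{m_1}\cdots\left(\frac{t_n-i}{t_n+i}\right)^{m_n}\prod_{\ell=1}^n\frac{1}{1+t_\ell^2}\,d\mu(\vec t)=0$$ for all multiindices $\vec m\in\mathbb{Z}^n$ with at least one positive entry and at least one negative entry. (d) $$\int_{\mathbb{R}^n}\frac{1}{(t_{j_1}-z_{j_1})^2(t_{j_2}-\overline{z_{j_2}})^2}\prod_{\substack{\ell=1\\ \ell\ne j_1,j_2}}^n\left(\frac{1}{t_\ell-z_\ell}-\frac{1}{t_\ell-\overline{z_\ell}}\right)d\mu(\vec t)=0$$ for all $\vec z\in(\mathbb{C}^+)^n$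 and for all indices $j_1,j_2\in\mathbb{N}$ such that $1\le j_1<j_2\le n$.
   Context: $\mathbb{C}^+=\{z\in\mathbb{C}: \mathrm{Im}\,z>0\}$ and $i$ is the imaginary unit. For $j\in\{1,\dots,n\}$ (depending on $z_j\in\mathbb{C}^+$ and $t_j\in\mathbb{R}$) $$N_{-1,j}:=\frac{1}{t_j-z_j}-\frac{1}{t_j-i},\quad N_{0,j}:=\frac{1}{t_j-i}-\frac{1}{t_j+i},\quad N_{1,j}:=\frac{1}{t_j+i}-\frac{1}{t_j-\overline{z_j}}.$$ The notation "$-1\in\vec\rho\wedge 1\in\vec\rho$" means that the vector $\vec\rho$ has at least one entry equal to $-1$ and at least one entry equal to $1$. *)

theory Defs
  imports "HOL-Analysis.Analysis"
begin

text \<open>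
  The coordinates of \<open>\<real>\<^sup>n\<close> are indexed by a finite linearly ordered type \<open>'n\<close>,
  which plays the role of \<open>{1,\<dots>,n}\<close> with \<open>n = CARD('n)\<close>. The order is used only for the
  condition \<open>j\<^sub>1 < j\<^sub>2\<close>.
\<close>

definition upper_half_plane :: "complex set" where
  "upper_half_plane = {z. Im z > 0}"

text \<open>The value \<open>0\<close> for \<open>\<rho> \<notin> {-1,0,1}\<close> is a dummy that is never used.\<close>

definition Nfun :: "int \<Rightarrow> complex \<Rightarrow> real \<Rightarrow> complex" where
  "Nfun \<rho> z t =
    (if \<rho> = -1 then 1 / (of_real t - z) - 1 / (of_real t - \<i>)
     else if \<rho> = 0 then 1 / (of_real t - \<i>) - 1 / (of_real t + \<i>)
     else if \<rho> = 1 then 1 / (of_real t + \<i>) - 1 / (of_real t - cnj z)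
     else 0)"

definition mixed_vectors :: "(int^'n) set" where
  "mixed_vectors =
    {\<rho>. (\<forall>j. \<rho> $ j \<in> {-1, 0, 1}) \<and> (\<exists>j. \<rho> $ j = -1) \<and> (\<exists>j. \<rho> $ j = 1)}"

text \<open>Finiteness makes the sum in condition (a) a genuine one.\<close>

lemma finite_mixed_vectors: "finite (mixed_vectors :: (int^'n) set)"
proof -
  have "finite (UNIV \<rightarrow>\<^sub>E {-1, 0, 1} :: ('n \<Rightarrow> int) set)"
    by (intro finite_PiE) auto
  then have "finite (vec_lambda ` (UNIV \<rightarrow>\<^sub>E {-1, 0, 1} :: ('n \<Rightarrow> int) set))"
    by (rule finite_imageI)
  moreover have "(mixed_vectors :: (int^'n) set) \<subseteq> vec_lambda ` (UNIV \<rightarrow>\<^sub>E {-1, 0, 1})"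
  proof
    fix \<rho> :: "int^'n"
    assume "\<rho> \<in> mixed_vectors"
    then have "vec_nth \<rho> \<in> UNIV \<rightarrow>\<^sub>E {-1, 0, 1}"
      by (auto simp: mixed_vectors_def PiE_def Pi_def)
    then show "\<rho> \<in> vec_lambda ` (UNIV \<rightarrow>\<^sub>E {-1, 0, 1})"
      by (rule rev_image_eqI) simp
  qed
  ultimately show ?thesis
    by (rule finite_subset[rotated])
qed

text \<open>
  Under the growth condition on \<open>\<mu>\<close>, every integrand in (a)--(d) is bounded by a constant multiple
  of \<open>\<Prod>\<^sub>\<ell> 1 / (1 + t\<^sub>\<ell>\<^sup>2)\<close>, so no Bochner integral below takes its default value \<open>0\<close>.
\<close>

definition cond_a :: "(real^'n) measure \<Rightarrow> bool" where
  "cond_a \<mu> \<longleftrightarrow>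
    (\<forall>z :: complex^'n. (\<forall>j. z $ j \<in> upper_half_plane) \<longrightarrow>
      (\<Sum>\<rho>\<in>mixed_vectors. LINT t|\<mu>. (\<Prod>j\<in>UNIV. Nfun (\<rho> $ j) (z $ j) (t $ j))) = 0)"

definition cond_b :: "(real^'n) measure \<Rightarrow> bool" where
  "cond_b \<mu> \<longleftrightarrow>
    (\<forall>z :: complex^'n. (\<forall>j. z $ j \<in> upper_half_plane) \<longrightarrow>
      (\<forall>\<rho>\<in>mixed_vectors. (LINT t|\<mu>. (\<Prod>j\<in>UNIV. Nfun (\<rho> $ j) (z $ j) (t $ j))) = 0))"

definition cond_c :: "(real^'n) measure \<Rightarrow> bool" where
  "cond_c \<mu> \<longleftrightarrow>
    (\<forall>m :: int^'n. (\<exists>j. m $ j > 0) \<and> (\<exists>j. m $ j < 0) \<longrightarrow>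
      (LINT t|\<mu>.
        (\<Prod>j\<in>UNIV. ((of_real (t $ j) - \<i>) / (of_real (t $ j) + \<i>)) powi (m $ j))
        * (\<Prod>l\<in>UNIV. 1 / (1 + complex_of_real (t $ l) ^ 2))) = 0)"

definition cond_d :: "(real^('n::{finite,linorder})) measure \<Rightarrow> bool" where
  "cond_d \<mu> \<longleftrightarrow>
    (\<forall>z :: complex^('n::{finite,linorder}). (\<forall>j. z $ j \<in> upper_half_plane) \<longrightarrow>
      (\<forall>j1 j2. j1 < j2 \<longrightarrow>
        (LINT t|\<mu>.
          1 / ((of_real (t $ j1) - z $ j1) ^ 2 * (of_real (t $ j2) - cnj (z $ j2)) ^ 2)
          * (\<Prod>l\<in>UNIV - {j1, j2}.
              1 / (of_real (t $ l) - z $ l) - 1 / (of_real (t $ l) - cnj (z $ l)))) = 0))"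

end

theory Submission
  imports Defs "HOL-Complex_Analysis.Cauchy_Integral_Formula"
begin

text \<open>
  The Cayley transform \<open>z \<mapsto> (z - \<i>) / (z + \<i>)\<close> maps the real line to the unit circle and the upper
  half-plane onto the unit disk. With \<open>u\<close> the image of \<open>t\<close> and \<open>\<zeta>\<close> the image of \<open>z\<close>, multiplication
  by \<open>1 + t\<^sup>2\<close> turns the functions \<open>N\<^sub>-\<^sub>1\<close>, \<open>N\<^sub>0\<close>, \<open>N\<^sub>1\<close> into \<open>2 * \<i>\<close> times \<open>\<Sum>k\<ge>1. \<zeta>^k * u^(-k)\<close>, \<open>1\<close>
  and \<open>\<Sum>k\<ge>1. cnj \<zeta>^k * u^k\<close>, the parts of negative, zero and positive frequency of the Poisson
  kernel. Likewise \<open>1 / (t - z)\<^sup>2\<close> becomes a nonvanishing function of \<open>\<zeta>\<close> times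
  \<open>\<Sum>k\<ge>1. k * \<zeta>^(k-1) * u^(-k)\<close>. Hence all four conditions are about the moments
  \<open>\<integral> u^m * \<Prod> 1 / (1 + t\<^sup>2) d\<mu>\<close> with \<open>m\<close> a mixed multiindex; (c) says that all of these vanish.

  From moments to integrals: the factors are absolutely convergent Fourier series, so an integral of
  a product vanishes as soon as every moment whose frequencies occur in all the factors does
  (\<open>integral_zero_if_moments_zero\<close>). In (b) and (d) only mixed frequencies occur.

  From integrals to moments: the left-hand side of (a), or of (d) after rescaling by a function of
  \<open>\<zeta>\<close>, is a harmonic series in each \<open>\<zeta>\<^sub>j\<close>, and on each ray a power series in the radius, so it determines
  its coefficients. Doing this one coordinate after the other isolates a single multiindex
  (\<open>fourier_coefficients_vanish\<close>). In (a)
  the three kernels have disjoint spectra, so only \<open>\<rho> = sgn m\<close> contributes to the multiindex \<open>m\<close>. In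
  (d) only \<open>j\<^sub>1 < j\<^sub>2\<close> is available, but since \<open>\<mu>\<close> is positive the moments at \<open>m\<close> and \<open>-m\<close> are conjugate,
  which supplies the other order.
\<close>

section \<open>Absolutely convergent Fourier series on the unit circle\<close>

text \<open>
  Pairing the frequencies \<open>n\<close> and \<open>-n\<close> turns a series over \<open>\<int>\<close> into one over \<open>\<nat>\<close>. At radius \<open>r\<close> the
  two paired terms carry the same power \<open>r\<^sup>n\<close>, so a harmonic function on the disk becomes an
  ordinary power series in \<open>r\<close>.
\<close>

definition two_sided :: "(int \<Rightarrow> complex) \<Rightarrow> nat \<Rightarrow> complex" where
  "two_sided c n = (if n = 0 then c 0 else c (int n) + c (- int n))"

text \<open>
  Only the values of \<open>F\<close> on the unit circle matter. Summability of the norms makes the series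
  dominated uniformly in \<open>u\<close>; it bounds \<open>F\<close> there and permits integration term by term.
\<close>

definition has_fourier :: "(complex \<Rightarrow> complex) \<Rightarrow> (int \<Rightarrow> complex) \<Rightarrow> bool" where
  "has_fourier F c \<longleftrightarrow>
    summable (\<lambda>n. norm (c (int n)) + norm (c (- int n))) \<and>
    (\<forall>u. norm u = 1 \<longrightarrow> two_sided (\<lambda>k. c k * u powi k) sums F u)"

lemma has_fourierD:
  assumes "has_fourier F c"
  shows has_fourier_summable: "summable (\<lambda>n. norm (c (int n)) + norm (c (- int n)))"
    and has_fourier_sums: "norm u = 1 \<Longrightarrow> two_sided (\<lambda>k. c k * u powi k) sums F u"
  using assms by (auto simp: has_fourier_def)

lemma norm_two_sided_le:
  assumes "norm u = 1"
  shows "norm (two_sided (\<lambda>k. c k * u powi k) n) \<le> norm (c (int n)) + norm (c (- int n))"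
proof -
  have "norm (c k * u powi k) = norm (c k)" for k
    using assms by (simp add: norm_mult norm_power_int)
  then show ?thesis
    using norm_triangle_ineq[of "c (int n) * u powi int n" "c (- int n) * u powi (- int n)"]
    by (auto simp: two_sided_def simp del: power_int_of_nat)
qed

lemma has_fourier_bounded:
  assumes "has_fourier F c"
  obtains B where "\<And>u. norm u = 1 \<Longrightarrow> norm (F u) \<le> B"
proof
  fix u :: complex assume u: "norm u = 1"
  show "norm (F u) \<le> (\<Sum>n. norm (c (int n)) + norm (c (- int n)))"
    by (rule norm_sums_le[OF has_fourier_sums[OF assms u] summable_sums[OF has_fourier_summable[OF assms]]])
      (rule norm_two_sided_le[OF u])
qed

lemma borel_measurable_power_int [measurable]:
  fixes f :: "'a \<Rightarrow> complex"
  assumes [measurable]: "f \<in> borel_measurable M"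
  shows "(\<lambda>x. f x powi k) \<in> borel_measurable M"
  unfolding power_int_def by (cases "k \<ge> 0") simp_all

lemma borel_measurable_two_sided:
  assumes [measurable]: "U \<in> borel_measurable M"
  shows "(\<lambda>x. two_sided (\<lambda>k. c k * U x powi k) n) \<in> borel_measurable M"
  unfolding two_sided_def by (cases "n = 0") (simp_all del: power_int_of_nat)

text \<open>
  The composition is a pointwise limit of partial sums, which are measurable.
\<close>

lemma has_fourier_measurable:
  assumes F: "has_fourier F c" and U: "U \<in> borel_measurable M" "\<And>x. norm (U x) = 1"
  shows "(\<lambda>x. F (U x)) \<in> borel_measurable M"
proof -
  have "(\<lambda>x. \<Sum>n. two_sided (\<lambda>k. c k * U x powi k) n) \<in> borel_measurable M"
    by (intro borel_measurable_suminf borel_measurable_two_sided U)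
  moreover have "(\<Sum>n. two_sided (\<lambda>k. c k * U x powi k) n) = F (U x)" for x
    by (rule sums_unique[symmetric, OF has_fourier_sums[OF F U(2)]])
  ultimately show ?thesis by simp
qed

lemma integrable_bounded_mult:
  fixes f h :: "'a \<Rightarrow> complex"
  assumes h: "integrable M h" and f: "f \<in> borel_measurable M" "\<And>x. norm (f x) \<le> B"
  shows "integrable M (\<lambda>x. f x * h x)"
proof (rule Bochner_Integration.integrable_bound)
  show "integrable M (\<lambda>x. B * norm (h x))" using h by simp
  show "(\<lambda>x. f x * h x) \<in> borel_measurable M"
    using f(1) borel_measurable_integrable[OF h] by simp
  have "norm (f x * h x) \<le> norm (B * norm (h x))" for x
    using mult_right_mono[OF f(2)[of x], of "norm (h x)"]
    by (simp add: norm_mult abs_mult order_trans[OF _ mult_right_mono[OF abs_ge_self]])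
  then show "AE x in M. norm (f x * h x) \<le> norm (B * norm (h x))" by simp
qed

lemma integrable_prod_bounded_mult:
  fixes f :: "'n \<Rightarrow> 'a \<Rightarrow> complex"
  assumes "finite A" "integrable M h"
    and "\<And>j. j \<in> A \<Longrightarrow> f j \<in> borel_measurable M"
    and "\<And>j. j \<in> A \<Longrightarrow> \<exists>B. \<forall>x. norm (f j x) \<le> B"
  shows "integrable M (\<lambda>x. (\<Prod>j\<in>A. f j x) * h x)"
  using assms
proof (induction A rule: finite_induct)
  case (insert a A)
  then obtain B where "\<And>x. norm (f a x) \<le> B" by blast
  then have "integrable M (\<lambda>x. f a x * ((\<Prod>j\<in>A. f j x) * h x))"
    using insert by (intro integrable_bounded_mult[where f = "f a" and B = B]) auto
  then show ?case using insert by (simp add: mult.assoc)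
qed simp

section \<open>Integrals against Fourier series\<close>

text \<open>
  The coefficients are summable and \<open>\<bar>U\<bar> = 1\<close>, so the terms are dominated by a summable sequence
  times the fixed integrable function \<open>\<bar>h\<bar>\<close>, and summation and integration can be exchanged.
\<close>

lemma fourier_integral_sums:
  assumes F: "has_fourier F c" and U: "U \<in> borel_measurable M" "\<And>x. norm (U x) = 1"
    and h: "integrable M h"
  shows "two_sided (\<lambda>k. c k * (LINT x|M. U x powi k * h x)) sums (LINT x|M. F (U x) * h x)"
proof -
  let ?b = "\<lambda>n. norm (c (int n)) + norm (c (- int n))"
  let ?f = "\<lambda>n x. two_sided (\<lambda>k. c k * U x powi k) n * h x"
  have pow: "integrable M (\<lambda>x. U x powi k * h x)" for k
    using U by (intro integrable_bounded_mult[where B = 1] h) (simp_all add: norm_power_int)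
  have int: "integrable M (?f n)" for n
    using h norm_two_sided_le[OF U(2)]
    by (intro integrable_bounded_mult[where B = "?b n"] borel_measurable_two_sided U)
  have le: "norm (?f n x) \<le> ?b n * norm (h x)" for n x
    using norm_two_sided_le[OF U(2)] by (simp add: norm_mult mult_right_mono)
  have sb: "summable ?b" using F by (rule has_fourier_summable)
  have "(\<lambda>n. LINT x|M. ?f n x) sums (LINT x|M. (\<Sum>n. ?f n x))"
  proof (rule sums_integral)
    show "integrable M (?f n)" for n by (rule int)
    show "AE x in M. summable (\<lambda>n. norm (?f n x))"
    proof (rule AE_I2)
      fix x
      show "summable (\<lambda>n. norm (?f n x))"
        by (rule summable_comparison_test'[OF summable_mult2[OF sb, of "norm (h x)"], of 0]) (use le in simp)
    qed
    show "summable (\<lambda>n. LINT x|M. norm (?f n x))"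
    proof (rule summable_comparison_test'[OF summable_mult2[OF sb, of "LINT x|M. norm (h x)"], of 0])
      fix n
      have "(LINT x|M. norm (?f n x)) \<le> (LINT x|M. ?b n * norm (h x))"
        using int h le by (intro integral_mono) auto
      then show "norm (LINT x|M. norm (?f n x)) \<le> ?b n * (LINT x|M. norm (h x))"
        by simp
    qed
  qed
  moreover have "(\<lambda>x. \<Sum>n. ?f n x) = (\<lambda>x. F (U x) * h x)"
    by (rule ext) (rule sums_unique[symmetric, OF sums_mult2[OF has_fourier_sums[OF F U(2)]]])
  moreover have "(LINT x|M. ?f n x) = two_sided (\<lambda>k. c k * (LINT x|M. U x powi k * h x)) n" for n
  proof (cases "n = 0")
    case False
    have "(LINT x|M. ?f n x) =
        (LINT x|M. c (int n) * (U x powi int n * h x) + c (- int n) * (U x powi (- int n) * h x))"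
      using False by (simp add: two_sided_def algebra_simps del: power_int_of_nat)
    also have "\<dots> = c (int n) * (LINT x|M. U x powi int n * h x)
        + c (- int n) * (LINT x|M. U x powi (- int n) * h x)"
      using pow[of "int n"] pow[of "- int n"]
      by (simp del: power_int_of_nat)
    finally show ?thesis using False by (simp add: two_sided_def del: power_int_of_nat)
  qed (simp add: two_sided_def)
  ultimately show ?thesis by (simp only:)
qed

lemma integral_zero_if_moments_zero_1dim:
  assumes "has_fourier F c" "U \<in> borel_measurable M" "\<And>x. norm (U x) = 1" "integrable M h"
    and zero: "\<And>k. c k \<noteq> 0 \<Longrightarrow> (LINT x|M. U x powi k * h x) = 0"
  shows "(LINT x|M. F (U x) * h x) = 0"
proof -
  have "c k * (LINT x|M. U x powi k * h x) = 0" for k using zero[of k] by auto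
  then have "two_sided (\<lambda>k. c k * (LINT x|M. U x powi k * h x)) = two_sided (\<lambda>k. 0)"
    by (simp only:)
  also have "\<dots> = (\<lambda>n. 0)" by (simp add: two_sided_def fun_eq_iff)
  finally have "two_sided (\<lambda>k. c k * (LINT x|M. U x powi k * h x)) = (\<lambda>n. 0)" .
  then show ?thesis
    using fourier_integral_sums[OF assms(1-4)] sums_unique2 sums_zero by metis
qed

text \<open>
  The multiple Fourier series is never formed. Monomials are replaced by the functions \<open>F j\<close> one
  coordinate at a time; all other factors are bounded and are absorbed into the integrable factor of
  the one-dimensional statement.
\<close>

lemma integral_zero_if_moments_zero:
  fixes U :: "'n::finite \<Rightarrow> 'a \<Rightarrow> complex"
  assumes F: "\<And>j. has_fourier (F j) (c j)"
    and U: "\<And>j. U j \<in> borel_measurable M" "\<And>j x. norm (U j x) = 1" and h: "integrable M h"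
    and zero: "\<And>m. (\<And>j. c j (m j) \<noteq> 0) \<Longrightarrow> (LINT x|M. (\<Prod>j\<in>UNIV. U j x powi m j) * h x) = 0"
  shows "(LINT x|M. (\<Prod>j\<in>UNIV. F j (U j x)) * h x) = 0"
proof -
  let ?G = "\<lambda>S m j x. if j \<in> S then F j (U j x) else U j x powi m j"
  have meas: "?G S m j \<in> borel_measurable M" for S m j
    using has_fourier_measurable[OF F U] U(1) by (cases "j \<in> S") simp_all
  have bound: "\<exists>B. \<forall>x. norm (?G S m j x) \<le> B" for S m j
  proof (cases "j \<in> S")
    case True
    then show ?thesis using has_fourier_bounded[OF F[of j]] U(2) by metis
  next
    case False
    then show ?thesis using U(2) by (intro exI[of _ 1]) (simp add: norm_power_int)
  qed
  have "(LINT x|M. (\<Prod>j\<in>UNIV. ?G S m j x) * h x) = 0"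
    if "\<And>j. j \<notin> S \<Longrightarrow> c j (m j) \<noteq> 0" for S m
    using finite[of S] that
  proof (induction S arbitrary: m rule: finite_induct)
    case empty
    then show ?case using zero[of m] by simp
  next
    case (insert a S)
    let ?h = "\<lambda>x. (\<Prod>j\<in>UNIV - {a}. ?G S m j x) * h x"
    have eq: "(LINT x|M. U a x powi k * ?h x) = (LINT x|M. (\<Prod>j\<in>UNIV. ?G S (m(a := k)) j x) * h x)" for k
    proof -
      have "(\<Prod>j\<in>UNIV. ?G S (m(a := k)) j x) = U a x powi k * (\<Prod>j\<in>UNIV - {a}. ?G S m j x)" for x
        by (subst prod.remove[of UNIV a]; (intro arg_cong2[where f = "(*)"] prod.cong)?)
          (use insert.hyps in auto)
      then show ?thesis by (simp add: mult.assoc)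
    qed
    have "(LINT x|M. F a (U a x) * ?h x) = 0"
    proof (rule integral_zero_if_moments_zero_1dim[OF F U])
      show "integrable M ?h"
        by (intro integrable_prod_bounded_mult h meas bound) simp
      show "(LINT x|M. U a x powi k * ?h x) = 0" if "c a k \<noteq> 0" for k
        unfolding eq by (rule insert.IH) (use insert.prems that in auto)
    qed
    moreover have "(\<Prod>j\<in>UNIV. ?G (insert a S) m j x) = F a (U a x) * (\<Prod>j\<in>UNIV - {a}. ?G S m j x)" for x
      by (subst prod.remove[of UNIV a]) (auto intro!: prod.cong)
    ultimately show ?case by (simp add: mult.assoc)
  qed
  from this[of UNIV] show ?thesis by simp
qed

section \<open>Recovering coefficients from a harmonic series on the disk\<close>

text \<open>
  The harmonic extension of \<open>u \<mapsto> u powi (-k)\<close> from the circle to the disk.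
\<close>

definition disk_pow :: "complex \<Rightarrow> int \<Rightarrow> complex" where
  "disk_pow \<zeta> k = (if k < 0 then \<zeta> ^ nat (- k) else cnj \<zeta> ^ nat k)"

text \<open>
  Convergence on the real segment already gives a complex disk of convergence, where zeros of a
  nontrivial power series are isolated.
\<close>

lemma powser_zero_imp_coeff_zero:
  fixes a :: "nat \<Rightarrow> complex"
  assumes "\<And>r::real. 0 \<le> r \<Longrightarrow> r < 1 \<Longrightarrow> (\<lambda>n. a n * of_real r ^ n) sums 0"
  shows "a n = 0"
proof (rule ccontr)
  assume n: "a n \<noteq> 0"
  define f where "f x = (\<Sum>n. a n * x ^ n)" for x
  have real0: "f (of_real r) = 0" if "0 \<le> r" "r < 1" for r :: real
    unfolding f_def using assms[OF that] by (rule sums_unique[symmetric])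
  have a0: "a 0 = 0" using real0[of 0] by (simp add: f_def powser_zero)
  have sm: "(\<lambda>n. a n * (x - 0) ^ n) sums f x" if "norm (x - 0) < 1/2" for x
  proof -
    have "summable (\<lambda>n. a n * x ^ n)"
      by (rule powser_inside[OF sums_summable[OF assms[of "1/2"]]]) (use that in \<open>auto simp: norm_divide\<close>)
    then show ?thesis by (simp add: f_def summable_sums)
  qed
  have "n > 0" using a0 n by (cases n) auto
  obtain s where "0 < s" and s: "\<And>z. z \<in> cball 0 s - {0} \<Longrightarrow> f z \<noteq> 0"
    using powser_0_nonzero[of "1/2" 0 a f n] sm real0[of 0] n \<open>n > 0\<close> by auto
  have "f (of_real (min s (1/2))) = 0" using \<open>0 < s\<close> by (intro real0) auto
  moreover have "complex_of_real (min s (1/2)) \<in> cball 0 s - {0}"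
    using \<open>0 < s\<close> by (auto simp: min_def)
  ultimately show False using s by blast
qed

lemma disk_pow_polar: "disk_pow (of_real r * v) k = of_real r ^ nat \<bar>k\<bar> * disk_pow v k"
  by (simp add: disk_pow_def power_mult_distrib)

text \<open>
  On the ray through \<open>v\<close> with \<open>\<bar>v\<bar> = 1\<close> the series is a power series in the radius, so every coefficient
  \<open>b n * cnj v ^ n + b (-n) * v ^ n\<close> of that power series vanishes. Two directions, one with
  \<open>v ^ n = 1\<close> and one with \<open>v ^ n = \<i>\<close>, separate \<open>b n\<close> from \<open>b (-n)\<close>.
\<close>

lemma harmonic_series_zero_imp_coeff_zero:
  assumes "\<And>\<zeta>. norm \<zeta> < 1 \<Longrightarrow> two_sided (\<lambda>k. b k * disk_pow \<zeta> k) sums 0"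
  shows "b k = 0"
proof -
  have vanish: "two_sided (\<lambda>k. b k * disk_pow v k) n = 0" if v: "norm v = 1" for v n
  proof (rule powser_zero_imp_coeff_zero)
    fix r :: real assume r: "0 \<le> r" "r < 1"
    have "two_sided (\<lambda>k. b k * disk_pow (of_real r * v) k) sums 0"
      using r v by (intro assms) (simp add: norm_mult)
    moreover have "two_sided (\<lambda>k. b k * disk_pow (of_real r * v) k) =
        (\<lambda>n. two_sided (\<lambda>k. b k * disk_pow v k) n * of_real r ^ n)"
      by (rule ext) (simp only: two_sided_def disk_pow_polar, simp add: algebra_simps)
    ultimately show "(\<lambda>n. two_sided (\<lambda>k. b k * disk_pow v k) n * of_real r ^ n) sums 0" by simp
  qed
  have pm: "b (int n) = 0 \<and> b (- int n) = 0" for n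
  proof (cases "n = 0")
    case True
    then show ?thesis using vanish[of 1 0] by (simp add: two_sided_def disk_pow_def)
  next
    case False
    \<comment> \<open>An \<open>n\<close>-th root of \<open>\<i>\<close>.\<close>
    let ?v = "cis (pi / (2 * real n))"
    have "real n * (pi / (2 * real n)) = pi / 2" using False by simp
    then have vn: "?v ^ n = \<i>" by (simp only: Complex.DeMoivre cis_pi_half)
    have "b (int n) + b (- int n) = 0"
      using vanish[of 1 n] False by (simp add: two_sided_def disk_pow_def)
    moreover have "b (int n) * (- \<i>) + b (- int n) * \<i> = 0"
      using vanish[of ?v n] False vn
      by (simp add: two_sided_def disk_pow_def flip: complex_cnj_power)
    then have "\<i> * (b (- int n) - b (int n)) = 0" by (simp add: algebra_simps)
    then have "b (- int n) = b (int n)" by simp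
    ultimately show ?thesis by simp
  qed
  show ?thesis using pm[of "nat \<bar>k\<bar>"] by (cases "k \<ge> 0") auto
qed

lemma two_sided_sum: "two_sided (\<lambda>k. \<Sum>\<rho>\<in>R. c \<rho> k) n = (\<Sum>\<rho>\<in>R. two_sided (c \<rho>) n)"
  by (simp add: two_sided_def sum.distrib)

text \<open>
  Exchanging sum and integral shows that the hypothesis is about a harmonic series in \<open>\<zeta>\<close> with
  the claimed quantities as coefficients. The outer sum over \<open>R\<close> is kept because its terms need not
  vanish separately.
\<close>

lemma fourier_coefficients_vanish_1dim:
  assumes F: "\<And>\<rho> \<zeta>. \<rho> \<in> R \<Longrightarrow> norm \<zeta> < 1 \<Longrightarrow> has_fourier (F \<rho> \<zeta>) (\<lambda>k. c \<rho> k * disk_pow \<zeta> k)"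
    and U: "U \<in> borel_measurable M" "\<And>x. norm (U x) = 1"
    and h: "\<And>\<rho>. \<rho> \<in> R \<Longrightarrow> integrable M (h \<rho>)"
    and zero: "\<And>\<zeta>. norm \<zeta> < 1 \<Longrightarrow> (\<Sum>\<rho>\<in>R. LINT x|M. F \<rho> \<zeta> (U x) * h \<rho> x) = 0"
  shows "(\<Sum>\<rho>\<in>R. c \<rho> k * (LINT x|M. U x powi k * h \<rho> x)) = 0"
proof -
  let ?I = "\<lambda>\<rho> k. LINT x|M. U x powi k * h \<rho> x"
  have "two_sided (\<lambda>k. (\<Sum>\<rho>\<in>R. c \<rho> k * ?I \<rho> k) * disk_pow \<zeta> k) sums 0" if \<zeta>: "norm \<zeta> < 1" for \<zeta>
  proof -
    have "(\<lambda>n. \<Sum>\<rho>\<in>R. two_sided (\<lambda>k. (c \<rho> k * disk_pow \<zeta> k) * ?I \<rho> k) n) sums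
        (\<Sum>\<rho>\<in>R. LINT x|M. F \<rho> \<zeta> (U x) * h \<rho> x)"
      by (intro sums_sum fourier_integral_sums F U h \<zeta>)
    then show ?thesis
      unfolding zero[OF \<zeta>] two_sided_sum[symmetric] sum_distrib_right
      by (simp add: algebra_simps)
  qed
  then show ?thesis by (rule harmonic_series_zero_imp_coeff_zero)
qed

text \<open>
  The parameters \<open>\<zeta> j\<close> are eliminated one at a time: each application of the one-dimensional
  statement replaces the factor \<open>F \<rho> j (\<zeta> j)\<close> by the \<open>m j\<close>-th term of its series, whose coefficient
  depends on \<open>\<rho>\<close> and therefore stays inside the sum.
\<close>

lemma fourier_coefficients_vanish:
  fixes U :: "'n::finite \<Rightarrow> 'a \<Rightarrow> complex"
  assumes F: "\<And>\<rho> j \<zeta>. \<rho> \<in> R \<Longrightarrow> norm \<zeta> < 1 \<Longrightarrow>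
      has_fourier (F \<rho> j \<zeta>) (\<lambda>k. c \<rho> j k * disk_pow \<zeta> k)"
    and U: "\<And>j. U j \<in> borel_measurable M" "\<And>j x. norm (U j x) = 1" and h: "integrable M h"
    and zero: "\<And>\<zeta>. (\<And>j. norm (\<zeta> j) < 1) \<Longrightarrow>
      (\<Sum>\<rho>\<in>R. LINT x|M. (\<Prod>j\<in>UNIV. F \<rho> j (\<zeta> j) (U j x)) * h x) = 0"
  shows "(\<Sum>\<rho>\<in>R. \<Prod>j\<in>UNIV. c \<rho> j (m j)) * (LINT x|M. (\<Prod>j\<in>UNIV. U j x powi m j) * h x) = 0"
proof -
  let ?G = "\<lambda>S \<zeta> \<rho> j x. if j \<in> S then c \<rho> j (m j) * U j x powi m j else F \<rho> j (\<zeta> j) (U j x)"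
  have meas: "?G S \<zeta> \<rho> j \<in> borel_measurable M" if "\<rho> \<in> R" "\<And>j. norm (\<zeta> j) < 1" for S \<zeta> \<rho> j
    using has_fourier_measurable[OF F[of \<rho> "\<zeta> j" j] U] U(1) that by (cases "j \<in> S") simp_all
  have bound: "\<exists>B. \<forall>x. norm (?G S \<zeta> \<rho> j x) \<le> B" if "\<rho> \<in> R" "\<And>j. norm (\<zeta> j) < 1" for S \<zeta> \<rho> j
  proof (cases "j \<in> S")
    case True
    then show ?thesis using U(2)
      by (intro exI[of _ "norm (c \<rho> j (m j))"]) (simp add: norm_power_int norm_mult)
  next
    case False
    then show ?thesis using has_fourier_bounded[OF F[OF that(1) that(2)[of j], of j]] U(2) by metis
  qed
  have "(\<Sum>\<rho>\<in>R. LINT x|M. (\<Prod>j\<in>UNIV. ?G S \<zeta> \<rho> j x) * h x) = 0"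
    if "\<And>j. norm (\<zeta> j) < 1" for S \<zeta>
    using finite[of S] that
  proof (induction S arbitrary: \<zeta> rule: finite_induct)
    case empty
    then show ?case using zero[of \<zeta>] by simp
  next
    case (insert a S)
    let ?h = "\<lambda>\<rho> x. (\<Prod>j\<in>UNIV - {a}. ?G S \<zeta> \<rho> j x) * h x"
    have eq: "F \<rho> a \<xi> (U a x) * ?h \<rho> x = (\<Prod>j\<in>UNIV. ?G S (\<zeta>(a := \<xi>)) \<rho> j x) * h x" for \<rho> \<xi> x
    proof -
      have "(\<Prod>j\<in>UNIV. ?G S (\<zeta>(a := \<xi>)) \<rho> j x) = F \<rho> a \<xi> (U a x) * (\<Prod>j\<in>UNIV - {a}. ?G S \<zeta> \<rho> j x)"
        by (subst prod.remove[of UNIV a]; (intro arg_cong2[where f = "(*)"] prod.cong)?)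
          (use insert.hyps in auto)
      then show ?thesis by (simp add: mult.assoc)
    qed
    have "(\<Sum>\<rho>\<in>R. c \<rho> a (m a) * (LINT x|M. U a x powi m a * ?h \<rho> x)) = 0"
    proof (rule fourier_coefficients_vanish_1dim[where F = "\<lambda>\<rho>. F \<rho> a", OF F U])
      show "integrable M (?h \<rho>)" if "\<rho> \<in> R" for \<rho>
        using that insert.prems by (intro integrable_prod_bounded_mult h meas bound) simp_all
      show "(\<Sum>\<rho>\<in>R. LINT x|M. F \<rho> a \<xi> (U a x) * ?h \<rho> x) = 0" if "norm \<xi> < 1" for \<xi>
        unfolding eq by (rule insert.IH) (use insert.prems that in auto)
    qed
    moreover have "c \<rho> a (m a) * (LINT x|M. U a x powi m a * ?h \<rho> x) =
        (LINT x|M. (\<Prod>j\<in>UNIV. ?G (insert a S) \<zeta> \<rho> j x) * h x)" for \<rho>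
    proof -
      have "(\<Prod>j\<in>UNIV. ?G (insert a S) \<zeta> \<rho> j x) =
          c \<rho> a (m a) * U a x powi m a * (\<Prod>j\<in>UNIV - {a}. ?G S \<zeta> \<rho> j x)" for x
        by (subst prod.remove[of UNIV a]) (auto intro!: prod.cong)
      then show ?thesis by (simp add: mult.assoc)
    qed
    ultimately show ?case by simp
  qed
  from this[of "\<lambda>_. 0" UNIV] show ?thesis
    by (simp add: prod.distrib sum_distrib_right mult.assoc)
qed

section \<open>Calculus of Fourier series and the basic kernels\<close>

lemma has_fourier_cong:
  assumes "has_fourier F c" "\<And>u. F u = G u" "\<And>k. c k = d k"
  shows "has_fourier G d"
proof -
  have "F = G" "c = d" using assms(2,3) by auto
  then show ?thesis using assms(1) by simp
qed

lemma has_fourier_cmult: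
  assumes "has_fourier F c"
  shows "has_fourier (\<lambda>u. a * F u) (\<lambda>k. a * c k)"
proof -
  have "two_sided (\<lambda>k. a * c k * u powi k) = (\<lambda>n. a * two_sided (\<lambda>k. c k * u powi k) n)" for u
    by (rule ext) (simp add: two_sided_def algebra_simps)
  moreover have "(\<lambda>n. norm (a * c (int n)) + norm (a * c (- int n))) =
      (\<lambda>n. norm a * (norm (c (int n)) + norm (c (- int n))))"
    by (simp add: norm_mult algebra_simps)
  ultimately show ?thesis
    using assms by (simp add: has_fourier_def sums_mult summable_mult)
qed

lemma has_fourier_add:
  assumes "has_fourier F c" "has_fourier G d"
  shows "has_fourier (\<lambda>u. F u + G u) (\<lambda>k. c k + d k)"
  unfolding has_fourier_def
proof (intro conjI allI impI)
  show "summable (\<lambda>n. norm (c (int n) + d (int n)) + norm (c (- int n) + d (- int n)))"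
    by (rule summable_comparison_test'[OF
          summable_add[OF has_fourier_summable[OF assms(1)] has_fourier_summable[OF assms(2)]], of 0])
      (smt (verit) norm_triangle_ineq norm_ge_zero real_norm_def)
  fix u :: complex assume u: "norm u = 1"
  have "two_sided (\<lambda>k. (c k + d k) * u powi k) =
      (\<lambda>n. two_sided (\<lambda>k. c k * u powi k) n + two_sided (\<lambda>k. d k * u powi k) n)"
    by (rule ext) (simp add: two_sided_def algebra_simps)
  then show "two_sided (\<lambda>k. (c k + d k) * u powi k) sums (F u + G u)"
    using sums_add[OF has_fourier_sums[OF assms(1) u] has_fourier_sums[OF assms(2) u]] by simp
qed

lemma cnj_powi_unit:
  assumes "norm u = 1" shows "cnj (u powi k) = u powi (- k)"
proof -
  have "u * cnj u = 1"
    using assms by (simp flip: complex_norm_square)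
  then have "cnj u = inverse u" by (rule inverse_unique[symmetric])
  then show ?thesis by (simp add: power_int_minus power_int_inverse)
qed

lemma has_fourier_cnj:
  assumes "has_fourier F c"
  shows "has_fourier (\<lambda>u. cnj (F u)) (\<lambda>k. cnj (c (- k)))"
  unfolding has_fourier_def
proof (intro conjI allI impI)
  show "summable (\<lambda>n. norm (cnj (c (- int n))) + norm (cnj (c (- (- int n)))))"
    using has_fourier_summable[OF assms] by (simp add: add.commute)
  fix u :: complex assume u: "norm u = 1"
  have "two_sided (\<lambda>k. cnj (c (- k)) * u powi k) = (\<lambda>n. cnj (two_sided (\<lambda>k. c k * u powi k) n))"
    by (rule ext) (simp add: two_sided_def cnj_powi_unit[OF u] add.commute
        del: power_int_of_nat complex_cnj_power_int)
  then show "two_sided (\<lambda>k. cnj (c (- k)) * u powi k) sums cnj (F u)"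
    using has_fourier_sums[OF assms u] by (simp add: sums_cnj)
qed

lemma has_fourier_const: "has_fourier (\<lambda>u. a) (\<lambda>k. if k = 0 then a else 0)"
proof -
  have "two_sided (\<lambda>k. (if k = 0 then a else 0) * u powi k) = (\<lambda>n. if n = 0 then a else 0)" for u
    by (rule ext) (simp add: two_sided_def)
  moreover have "summable (\<lambda>n. norm (if int n = 0 then a else 0) + norm (if - int n = 0 then a else 0))"
    by (rule summable_finite[of "{0}"]) auto
  ultimately show ?thesis
    using sums_single[of 0 "\<lambda>_. a"] by (simp add: has_fourier_def)
qed

lemma has_fourier_negI:
  assumes "summable (\<lambda>n. norm (a n))" "a 0 = 0"
    and "\<And>u. norm u = 1 \<Longrightarrow> (\<lambda>n. a n * inverse u ^ n) sums F u"
  shows "has_fourier F (\<lambda>k. if k < 0 then a (nat (- k)) else 0)"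
proof -
  have "two_sided (\<lambda>k. (if k < 0 then a (nat (- k)) else 0) * u powi k) = (\<lambda>n. a n * inverse u ^ n)" for u
    using assms(2) by (intro ext) (simp add: two_sided_def power_int_minus power_inverse)
  moreover have "norm (if int n < 0 then a (nat (- int n)) else 0) +
      norm (if - int n < 0 then a (nat (- (- int n))) else 0) = norm (a n)" for n
    using assms(2) by auto
  ultimately show ?thesis
    using assms(1,3) unfolding has_fourier_def by simp
qed

lemma norm_mult_inverse_unit: "norm u = 1 \<Longrightarrow> norm \<zeta> < 1 \<Longrightarrow> norm (\<zeta> * inverse u) < 1"
  for u \<zeta> :: complex
  by (simp add: norm_mult norm_inverse)

lemma has_fourier_cauchy:
  assumes \<zeta>: "norm \<zeta> < 1"
  shows "has_fourier (\<lambda>u. \<zeta> / (u - \<zeta>)) (\<lambda>k. if k < 0 then disk_pow \<zeta> k else 0)"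
proof -
  have "has_fourier (\<lambda>u. \<zeta> / (u - \<zeta>))
      (\<lambda>k. if k < 0 then (if nat (- k) = 0 then 0 else \<zeta> ^ nat (- k)) else 0)"
  proof (rule has_fourier_negI)
    show "summable (\<lambda>n. norm (if n = 0 then 0 else \<zeta> ^ n))"
      by (rule summable_comparison_test'[OF summable_geometric[of "norm \<zeta>"], of 0])
        (use \<zeta> in \<open>auto simp: norm_power\<close>)
    fix u :: complex assume u: "norm u = 1"
    have "(\<lambda>n. (\<zeta> * inverse u) ^ n - (if n = 0 then 1 else 0)) sums (1 / (1 - \<zeta> * inverse u) - 1)"
      using sums_single[of 0 "\<lambda>_. 1 :: complex"]
      by (intro sums_diff geometric_sums norm_mult_inverse_unit u \<zeta>) simp
    moreover have "(\<lambda>n. (\<zeta> * inverse u) ^ n - (if n = 0 then 1 else 0)) =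
        (\<lambda>n. (if n = 0 then 0 else \<zeta> ^ n) * inverse u ^ n)"
      by (auto simp: power_mult_distrib)
    moreover have "1 / (1 - \<zeta> * inverse u) - 1 = \<zeta> / (u - \<zeta>)"
    proof -
      have "u \<noteq> 0" "u - \<zeta> \<noteq> 0" using u \<zeta> by auto
      then show ?thesis by (simp add: field_simps)
    qed
    ultimately show "(\<lambda>n. (if n = 0 then 0 else \<zeta> ^ n) * inverse u ^ n) sums (\<zeta> / (u - \<zeta>))" by simp
  qed simp
  then show ?thesis by (rule has_fourier_cong) (auto simp: disk_pow_def)
qed

text \<open>
  On the circle the function is \<open>inverse u / (1 - \<zeta> * inverse u)\<^sup>2\<close>, which is a termwise
  differentiated geometric series.
\<close>

lemma has_fourier_cauchy_square:
  assumes \<zeta>: "norm \<zeta> < 1"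
  shows "has_fourier (\<lambda>u. u / (u - \<zeta>)^2)
    (\<lambda>k. if k < 0 then of_nat (nat (- k)) * \<zeta> ^ (nat (- k) - 1) else 0)"
proof (rule has_fourier_negI[where a = "\<lambda>n. of_nat n * \<zeta> ^ (n - 1)"])
  have "summable (\<lambda>n. of_nat (Suc n) * norm \<zeta> ^ n)"
    using \<zeta> by (intro sums_summable[OF geometric_deriv_sums]) simp
  then have "summable (\<lambda>n. norm (of_nat (Suc n) * \<zeta> ^ (Suc n - 1)))"
    by (simp add: norm_mult norm_power flip: of_nat_Suc del: of_nat_Suc)
  then show "summable (\<lambda>n. norm (of_nat n * \<zeta> ^ (n - 1)))" by (subst (asm) summable_Suc_iff)
  fix u :: complex assume u: "norm u = 1"
  have "(\<lambda>n. inverse u * (of_nat (Suc n) * (\<zeta> * inverse u) ^ n)) sums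
      (inverse u * (1 / (1 - \<zeta> * inverse u)^2))"
    by (intro sums_mult geometric_deriv_sums norm_mult_inverse_unit u \<zeta>)
  then have "(\<lambda>n. of_nat (Suc n) * \<zeta> ^ (Suc n - 1) * inverse u ^ Suc n) sums
      (inverse u * (1 / (1 - \<zeta> * inverse u)^2))"
    by (simp add: power_mult_distrib algebra_simps)
  then have "(\<lambda>n. of_nat n * \<zeta> ^ (n - 1) * inverse u ^ n) sums
      (inverse u * (1 / (1 - \<zeta> * inverse u)^2))"
    by (subst (asm) sums_Suc_iff) simp
  moreover have "inverse u * (1 / (1 - \<zeta> * inverse u)^2) = u / (u - \<zeta>)^2"
  proof -
    have nz: "u \<noteq> 0" "u - \<zeta> \<noteq> 0" using u \<zeta> by auto
    have "1 - \<zeta> * inverse u = (u - \<zeta>) / u" using nz by (simp add: field_simps)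
    then show ?thesis using nz by (simp add: power_divide power2_eq_square divide_simps)
  qed
  ultimately show "(\<lambda>n. of_nat n * \<zeta> ^ (n - 1) * inverse u ^ n) sums (u / (u - \<zeta>)^2)" by simp
qed simp

section \<open>The Cayley transform\<close>

definition cayley :: "complex \<Rightarrow> complex" where
  "cayley z = (z - \<i>) / (z + \<i>)"

lemma real_plus_minus_i_nonzero: "complex_of_real t + \<i> \<noteq> 0" "complex_of_real t - \<i> \<noteq> 0"
  by (auto simp: complex_eq_iff)

lemma norm_cayley_real [simp]: "norm (cayley (of_real t)) = 1"
proof -
  have "norm (complex_of_real t - \<i>) = norm (complex_of_real t + \<i>)"
    by (simp add: cmod_def)
  then show ?thesis using real_plus_minus_i_nonzero[of t] by (simp add: cayley_def norm_divide)
qed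

lemma norm_minus_i_less_iff: "norm (z - \<i>) < norm (z + \<i>) \<longleftrightarrow> Im z > 0"
proof -
  have "norm (z - \<i>) < norm (z + \<i>) \<longleftrightarrow> (norm (z - \<i>))\<^sup>2 < (norm (z + \<i>))\<^sup>2"
    by (auto intro: power_strict_mono power2_less_imp_less)
  also have "\<dots> \<longleftrightarrow> Im z > 0" by (simp only: cmod_power2) (simp add: power2_eq_square algebra_simps)
  finally show ?thesis .
qed

lemma norm_cayley_less_1: "Im z > 0 \<Longrightarrow> norm (cayley z) < 1"
  using norm_minus_i_less_iff[of z] by (simp add: cayley_def norm_divide divide_simps) 

text \<open>
  Statements for all \<open>z\<close> in the half-plane thereby become statements for all \<open>\<zeta>\<close> in the disk, to which
  the uniqueness of harmonic series applies.
\<close>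

lemma cayley_onto_disk:
  assumes "norm \<zeta> < 1"
  obtains z where "z \<in> upper_half_plane" "cayley z = \<zeta>"
proof
  have nz: "1 - \<zeta> \<noteq> 0" using assms by auto
  define z where "z = \<i> * (1 + \<zeta>) / (1 - \<zeta>)"
  have p: "z + \<i> = 2 * \<i> / (1 - \<zeta>)" and m: "z - \<i> = 2 * \<i> * \<zeta> / (1 - \<zeta>)"
    using nz by (simp_all add: z_def field_simps)
  have "norm (z - \<i>) < norm (z + \<i>)"
    using assms nz by (simp add: p m norm_mult norm_divide divide_simps)
  then show "z \<in> upper_half_plane" by (simp add: upper_half_plane_def norm_minus_i_less_iff)
  show "cayley z = \<zeta>" using nz by (simp add: cayley_def p m)
qed

section \<open>The kernels in the disk picture\<close>

text \<open>
  The function \<open>(1 + t\<^sup>2) * Nfun \<rho> z t\<close> written in the variables \<open>\<zeta> = cayley z\<close> and \<open>u = cayley t\<close>.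
\<close>

definition N_kernel :: "int \<Rightarrow> complex \<Rightarrow> complex \<Rightarrow> complex" where
  "N_kernel \<rho> \<zeta> u =
    (if \<rho> = -1 then 2 * \<i> * (\<zeta> / (u - \<zeta>)) else if \<rho> = 0 then 2 * \<i>
     else if \<rho> = 1 then 2 * \<i> * cnj (\<zeta> / (u - \<zeta>)) else 0)"

lemma cnj_disk_pow_minus: "k \<noteq> 0 \<Longrightarrow> cnj (disk_pow \<zeta> (- k)) = disk_pow \<zeta> k"
  by (auto simp: disk_pow_def)

text \<open>
  The three kernels are the parts of negative, zero and positive frequency of the Poisson kernel
  (times \<open>2 * \<i>\<close>). Their spectra are disjoint, and this is what separates the terms of the sum in (a).
\<close>

lemma has_fourier_N_kernel:
  assumes "\<rho> \<in> {-1, 0, 1}" "norm \<zeta> < 1"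
  shows "has_fourier (N_kernel \<rho> \<zeta>) (\<lambda>k. (if sgn k = \<rho> then 2 * \<i> else 0) * disk_pow \<zeta> k)"
proof -
  consider "\<rho> = -1" | "\<rho> = 0" | "\<rho> = 1" using assms by auto
  then show ?thesis
  proof cases
    case 1
    show ?thesis
      by (rule has_fourier_cong[OF has_fourier_cmult[OF has_fourier_cauchy[OF assms(2)], of "2 * \<i>"]])
        (auto simp: 1 N_kernel_def sgn_if)
  next
    case 2
    show ?thesis
      by (rule has_fourier_cong[OF has_fourier_const[of "2 * \<i>"]])
        (auto simp: 2 N_kernel_def sgn_if disk_pow_def)
  next
    case 3
    show ?thesis
      by (rule has_fourier_cong[OF has_fourier_cmult[OF has_fourier_cnj[OF has_fourier_cauchy[OF assms(2)]],
            of "2 * \<i>"]])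
        (auto simp: 3 N_kernel_def sgn_if cnj_disk_pow_minus)
  qed
qed

lemma cayley_diff:
  assumes "Im z > 0"
  shows "cayley (of_real t) - cayley z = 2 * \<i> * (of_real t - z) / ((of_real t + \<i>) * (z + \<i>))"
proof -
  have "z + \<i> \<noteq> 0" using assms by (auto simp: complex_eq_iff)
  then show ?thesis using real_plus_minus_i_nonzero[of t]
    by (simp add: cayley_def divide_simps) (simp add: algebra_simps)
qed

lemma one_plus_square: "1 + complex_of_real t ^ 2 = (of_real t + \<i>) * (of_real t - \<i>)"
  by (simp add: algebra_simps power2_eq_square)

lemma Nfun_neg:
  assumes "Im z > 0"
  shows "Nfun (-1) z t = 
    N_kernel (-1) (cayley z) (cayley (of_real t)) * (1 / (1 + complex_of_real t ^ 2))"
proof -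
  have "z + \<i> \<noteq> 0" "of_real t - z \<noteq> 0" using assms by (auto simp: complex_eq_iff)
  then show ?thesis using real_plus_minus_i_nonzero[of t]
    unfolding one_plus_square N_kernel_def cayley_diff[OF assms] Nfun_def
    by (simp add: cayley_def divide_simps)
qed

text \<open>
  The case \<open>\<rho> = 1\<close> is minus the conjugate of the case \<open>\<rho> = -1\<close>, and \<open>cnj (2 * \<i>) = - 2 * \<i>\<close>
  restores the sign.
\<close>

lemma Nfun_eq_N_kernel:
  assumes "Im z > 0" "\<rho> \<in> {-1, 0, 1}"
  shows "Nfun \<rho> z t = N_kernel \<rho> (cayley z) (cayley (of_real t)) * (1 / (1 + complex_of_real t ^ 2))"
proof -
  have "Nfun 1 z t = - cnj (Nfun (-1) z t)" by (simp add: Nfun_def)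
  also have "\<dots> = N_kernel 1 (cayley z) (cayley (of_real t)) * (1 / (1 + complex_of_real t ^ 2))"
    by (simp add: Nfun_neg[OF assms(1)] N_kernel_def)
  finally have 1: "Nfun 1 z t = \<dots>" .
  have 0: "Nfun 0 z t = N_kernel 0 (cayley z) (cayley (of_real t)) * (1 / (1 + complex_of_real t ^ 2))"
    using real_plus_minus_i_nonzero[of t] unfolding one_plus_square
    by (simp add: Nfun_def N_kernel_def divide_simps)
  show ?thesis using 0 1 Nfun_neg[OF assms(1), of t] assms(2) by auto
qed

text \<open>
  The Poisson kernel of the disk times \<open>2 * \<i>\<close>; splitting it by frequency makes its Fourier series
  immediate.
\<close>

definition poisson :: "complex \<Rightarrow> complex \<Rightarrow> complex" where
  "poisson \<zeta> u = N_kernel (-1) \<zeta> u + N_kernel 0 \<zeta> u + N_kernel 1 \<zeta> u"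

lemma has_fourier_poisson:
  assumes "norm \<zeta> < 1"
  shows "has_fourier (poisson \<zeta>) (\<lambda>k. 2 * \<i> * disk_pow \<zeta> k)"
proof -
  have "has_fourier (\<lambda>u. N_kernel (-1) \<zeta> u + N_kernel 0 \<zeta> u + N_kernel 1 \<zeta> u)
     (\<lambda>k. (if sgn k = -1 then 2 * \<i> else 0) * disk_pow \<zeta> k + (if sgn k = 0 then 2 * \<i> else 0) * disk_pow \<zeta> k
       + (if sgn k = 1 then 2 * \<i> else 0) * disk_pow \<zeta> k)"
    by (intro has_fourier_add has_fourier_N_kernel assms) auto
  then show ?thesis by (rule has_fourier_cong) (auto simp: poisson_def sgn_if)
qed

lemma poisson_eq:
  assumes "Im z > 0"
  shows "1 / (of_real t - z) - 1 / (of_real t - cnj z) =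
    poisson (cayley z) (cayley (of_real t)) * (1 / (1 + complex_of_real t ^ 2))"
proof -
  have "1 / (of_real t - z) - 1 / (of_real t - cnj z) = Nfun (-1) z t + Nfun 0 z t + Nfun 1 z t"
    by (simp add: Nfun_def)
  then show ?thesis using Nfun_eq_N_kernel[OF assms] by (simp add: poisson_def algebra_simps)
qed

text \<open>
  The function \<open>(1 + t\<^sup>2) / (t - z)\<^sup>2\<close> in the variables \<open>\<zeta>\<close> and \<open>u\<close>. It is the \<open>z\<close>-derivative of
  \<open>N_kernel (-1)\<close>, with the factor \<open>(1 - \<zeta>)\<^sup>2\<close> coming from \<open>d\<zeta>/dz\<close>, so it has only negative
  frequencies, all with nonzero weight when \<open>\<zeta> \<noteq> 0\<close>.
\<close>

definition deriv_kernel :: "complex \<Rightarrow> complex \<Rightarrow> complex" where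
  "deriv_kernel \<zeta> u = (1 - \<zeta>)^2 * (u / (u - \<zeta>)^2)"

lemma deriv_kernel_eq:
  assumes "Im z > 0"
  shows "1 / (of_real t - z)^2 =
    deriv_kernel (cayley z) (cayley (of_real t)) * (1 / (1 + complex_of_real t ^ 2))"
proof -
  have "z + \<i> \<noteq> 0" "of_real t - z \<noteq> 0" using assms by (auto simp: complex_eq_iff)
  moreover from this have "1 - cayley z = 2 * \<i> / (z + \<i>)" by (simp add: cayley_def field_simps)
  ultimately show ?thesis using real_plus_minus_i_nonzero[of t]
    unfolding one_plus_square deriv_kernel_def cayley_diff[OF assms]
    by (simp add: cayley_def power_divide power_mult_distrib) (simp add: power2_eq_square divide_simps)
qed

lemma has_fourier_deriv_kernel:
  assumes "norm \<zeta> < 1"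
  shows "has_fourier (deriv_kernel \<zeta>)
    (\<lambda>k. (1 - \<zeta>)^2 * (if k < 0 then of_nat (nat (- k)) * \<zeta> ^ (nat (- k) - 1) else 0))"
  using has_fourier_cmult[OF has_fourier_cauchy_square[OF assms], of "(1 - \<zeta>)^2"]
  unfolding deriv_kernel_def .

section \<open>Moments of the measure on the torus\<close>

text \<open>
  Complex-valued, so that it can be a factor of the integrands.
\<close>

definition weight :: "real ^ 'n \<Rightarrow> complex" where
  "weight t = (\<Prod>l\<in>UNIV. 1 / (1 + complex_of_real (t $ l) ^ 2))"

definition unit_coord :: "'n \<Rightarrow> real ^ 'n \<Rightarrow> complex" where
  "unit_coord j t = cayley (of_real (t $ j))"

lemma norm_unit_coord: "norm (unit_coord j t) = 1"
  by (simp add: unit_coord_def)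

definition moment :: "(real ^ 'n) measure \<Rightarrow> ('n \<Rightarrow> int) \<Rightarrow> complex" where
  "moment \<mu> m = (LINT t|\<mu>. (\<Prod>j\<in>UNIV. unit_coord j t powi m j) * weight t)"

lemma weight_eq_of_real: "weight t = of_real (\<Prod>l\<in>UNIV. 1 / (1 + (t $ l)^2))"
  by (simp add: weight_def)

text \<open>
  The measure and the weight are real, and inversion is conjugation on the circle. This symmetry is
  what allows (d) to be restricted to \<open>j\<^sub>1 < j\<^sub>2\<close>.
\<close>

lemma moment_uminus: "moment \<mu> (\<lambda>j. - m j) = cnj (moment \<mu> m)"
proof -
  have "(\<Prod>j\<in>UNIV. unit_coord j t powi (- m j)) * weight t =
      cnj ((\<Prod>j\<in>UNIV. unit_coord j t powi m j) * weight t)" for t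
    by (simp only: complex_cnj_mult cnj_prod cnj_powi_unit[OF norm_unit_coord] weight_eq_of_real
        complex_cnj_complex_of_real)
  then show ?thesis by (simp add: moment_def del: complex_cnj_mult cnj_prod)
qed

lemma cond_c_iff_moments:
  "cond_c \<mu> \<longleftrightarrow> (\<forall>m. (\<exists>j. m j > 0) \<and> (\<exists>j. m j < 0) \<longrightarrow> moment \<mu> m = 0)"
proof -
  have "(LINT t|\<mu>. (\<Prod>j\<in>UNIV. ((of_real (t $ j) - \<i>) / (of_real (t $ j) + \<i>)) powi (m $ j))
        * (\<Prod>l\<in>UNIV. 1 / (1 + complex_of_real (t $ l) ^ 2))) = moment \<mu> (($) m)" for m :: "int ^ 'a"
    by (simp add: moment_def unit_coord_def weight_def cayley_def)
  moreover have "(\<forall>m :: int ^ 'a. P (($) m)) \<longleftrightarrow> (\<forall>m. P m)" for P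
    by (metis vec_lambda_inverse UNIV_I)
  ultimately show ?thesis unfolding cond_c_def by simp
qed

lemma measurable_unit_coord:
  assumes "sets \<mu> = sets borel"
  shows "unit_coord j \<in> borel_measurable \<mu>"
  unfolding measurable_cong_sets[OF assms refl] unit_coord_def cayley_def
  by (intro borel_measurable_continuous_onI continuous_intros) (simp add: real_plus_minus_i_nonzero)

lemma integrable_weight:
  assumes "sets \<mu> = sets borel"
    and "(\<integral>\<^sup>+ t. ennreal (\<Prod>l\<in>UNIV. 1 / (1 + (t $ l)^2)) \<partial>\<mu>) < \<infinity>"
  shows "integrable \<mu> (weight :: real ^ 'n \<Rightarrow> complex)"
proof (rule integrableI_bounded)
  have "1 + complex_of_real x ^ 2 \<noteq> 0" for x
    by (metis add_eq_0_iff no_zero_divisors one_plus_square real_plus_minus_i_nonzero)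
  then show "(weight :: real ^ 'n \<Rightarrow> complex) \<in> borel_measurable \<mu>"
    unfolding measurable_cong_sets[OF assms(1) refl] weight_def
    by (intro borel_measurable_continuous_onI continuous_intros) simp_all
  have "norm (weight t) = (\<Prod>l\<in>UNIV. 1 / (1 + (t $ l)^2))" for t :: "real ^ 'n"
    unfolding weight_eq_of_real norm_of_real by (intro abs_of_nonneg prod_nonneg) simp
  then show "(\<integral>\<^sup>+ t. ennreal (norm (weight (t :: real ^ 'n))) \<partial>\<mu>) < \<infinity>"
    using assms(2) by simp
qed

lemma prod_Nfun_eq:
  assumes "\<And>j. Im (z $ j) > 0" "\<And>j. \<rho> $ j \<in> {-1, 0, 1}"
  shows "(\<Prod>j\<in>UNIV. Nfun (\<rho> $ j) (z $ j) (t $ j)) =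
    (\<Prod>j\<in>UNIV. N_kernel (\<rho> $ j) (cayley (z $ j)) (unit_coord j t)) * weight t"
  unfolding weight_def unit_coord_def prod.distrib[symmetric]
  by (intro prod.cong refl Nfun_eq_N_kernel assms)

section \<open>Equivalence of the conditions\<close>

text \<open>
  A mixed \<open>\<rho>\<close> selects from the Fourier series only frequencies \<open>m\<close> with \<open>sgn (m j) = \<rho> j\<close>, and these
  are mixed as well.
\<close>

lemma cond_c_imp_cond_b:
  fixes \<mu> :: "(real ^ 'n) measure"
  assumes sets: "sets \<mu> = sets borel" and w: "integrable \<mu> (weight :: real ^ 'n \<Rightarrow> complex)"
    and "cond_c \<mu>"
  shows "cond_b \<mu>"
  unfolding cond_b_def
proof (intro allI impI ballI)
  fix z :: "complex ^ 'n" and \<rho> :: "int ^ 'n"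
  assume z: "\<forall>j. z $ j \<in> upper_half_plane" and \<rho>: "\<rho> \<in> mixed_vectors"
  have im: "Im (z $ j) > 0" for j using z by (simp add: upper_half_plane_def)
  have \<rho>3: "\<rho> $ j \<in> {-1, 0, 1}" for j using \<rho> by (simp add: mixed_vectors_def)
  obtain p q where pq: "\<rho> $ p = -1" "\<rho> $ q = 1" using \<rho> by (auto simp: mixed_vectors_def)
  have "(LINT t|\<mu>. (\<Prod>j\<in>UNIV. N_kernel (\<rho> $ j) (cayley (z $ j)) (unit_coord j t)) * weight t) = 0"
  proof (rule integral_zero_if_moments_zero[OF has_fourier_N_kernel[OF \<rho>3 norm_cayley_less_1[OF im]]
        measurable_unit_coord[OF sets] norm_unit_coord w])
    fix m :: "'n \<Rightarrow> int"
    assume "\<And>j. (if sgn (m j) = \<rho> $ j then 2 * \<i> else 0) * disk_pow (cayley (z $ j)) (m j) \<noteq> 0"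
    then have "sgn (m j) = \<rho> $ j" for j by (metis mult_zero_left)
    then have "m p < 0" "m q > 0"
      using pq by (metis sgn_less zero_less_one neg_less_0_iff_less, metis sgn_greater zero_less_one)
    then show "(LINT t|\<mu>. (\<Prod>j\<in>UNIV. unit_coord j t powi m j) * weight t) = 0"
      using assms(3) unfolding cond_c_iff_moments moment_def by blast
  qed
  then show "(LINT t|\<mu>. (\<Prod>j\<in>UNIV. Nfun (\<rho> $ j) (z $ j) (t $ j))) = 0"
    by (simp add: prod_Nfun_eq[OF im \<rho>3])
qed

lemma choose_in_half_plane:
  assumes "\<And>j::'n::finite. norm (\<zeta> j) < 1"
  obtains z :: "complex ^ 'n" where "\<forall>j. z $ j \<in> upper_half_plane" "\<forall>j. cayley (z $ j) = \<zeta> j"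
proof -
  have "\<forall>j. \<exists>z. z \<in> upper_half_plane \<and> cayley z = \<zeta> j"
    using cayley_onto_disk assms by metis
  then obtain f where "\<forall>j. f j \<in> upper_half_plane \<and> cayley (f j) = \<zeta> j" by metis
  then show ?thesis by (intro that[of "\<chi> j. f j"]) auto
qed

text \<open>
  The coefficient of the \<open>m\<close>-th moment in the sum of (a) receives a contribution from exactly one
  vector, namely \<open>\<rho> = sgn m\<close>, so it equals \<open>(2 * \<i>) ^ n\<close>, where \<open>n\<close> is the dimension.
\<close>

lemma cond_a_imp_cond_c:
  fixes \<mu> :: "(real ^ 'n) measure"
  assumes sets: "sets \<mu> = sets borel" and w: "integrable \<mu> (weight :: real ^ 'n \<Rightarrow> complex)"
    and a: "cond_a \<mu>"
  shows "cond_c \<mu>"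
  unfolding cond_c_iff_moments
proof (intro allI impI)
  fix m :: "'n \<Rightarrow> int"
  assume m: "(\<exists>j. m j > 0) \<and> (\<exists>j. m j < 0)"
  let ?c = "\<lambda>(\<rho> :: int ^ 'n) j k. if sgn k = \<rho> $ j then 2 * \<i> else 0"
  have "(\<Sum>\<rho>\<in>mixed_vectors. \<Prod>j\<in>UNIV. ?c \<rho> j (m j)) * moment \<mu> m = 0"
    unfolding moment_def
  proof (rule fourier_coefficients_vanish[where F = "\<lambda>\<rho> j. N_kernel (\<rho> $ j)",
        OF _ measurable_unit_coord[OF sets] norm_unit_coord w])
    show "has_fourier (N_kernel (\<rho> $ j) \<zeta>) (\<lambda>k. ?c \<rho> j k * disk_pow \<zeta> k)"
      if "\<rho> \<in> mixed_vectors" "norm \<zeta> < 1" for \<rho> :: "int ^ 'n" and j \<zeta>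
      using that by (intro has_fourier_N_kernel) (auto simp: mixed_vectors_def)
    fix \<zeta> :: "'n \<Rightarrow> complex" assume \<zeta>: "\<And>j. norm (\<zeta> j) < 1"
    obtain z :: "complex ^ 'n" where z: "\<forall>j. z $ j \<in> upper_half_plane" "\<forall>j. cayley (z $ j) = \<zeta> j"
      by (rule choose_in_half_plane[where \<zeta> = \<zeta>, OF \<zeta>])
    have "(\<Sum>\<rho>\<in>mixed_vectors. LINT t|\<mu>. (\<Prod>j\<in>UNIV. Nfun (\<rho> $ j) (z $ j) (t $ j))) = 0"
      using a z(1) by (simp add: cond_a_def)
    also have "(\<Sum>\<rho>\<in>mixed_vectors. LINT t|\<mu>. (\<Prod>j\<in>UNIV. Nfun (\<rho> $ j) (z $ j) (t $ j))) =
        (\<Sum>\<rho>\<in>mixed_vectors. LINT t|\<mu>. (\<Prod>j\<in>UNIV. N_kernel (\<rho> $ j) (\<zeta> j) (unit_coord j t)) * weight t)"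
    proof (rule sum.cong[OF refl])
      fix \<rho> :: "int ^ 'n" assume "\<rho> \<in> mixed_vectors"
      then have "\<rho> $ j \<in> {-1, 0, 1}" for j by (simp add: mixed_vectors_def)
      moreover have "Im (z $ j) > 0" for j using z(1) by (simp add: upper_half_plane_def)
      ultimately show "(LINT t|\<mu>. (\<Prod>j\<in>UNIV. Nfun (\<rho> $ j) (z $ j) (t $ j))) =
          (LINT t|\<mu>. (\<Prod>j\<in>UNIV. N_kernel (\<rho> $ j) (\<zeta> j) (unit_coord j t)) * weight t)"
        by (simp add: prod_Nfun_eq z(2))
    qed
    finally show "(\<Sum>\<rho>\<in>mixed_vectors. LINT t|\<mu>.
        (\<Prod>j\<in>UNIV. N_kernel (\<rho> $ j) (\<zeta> j) (unit_coord j t)) * weight t) = 0" .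
  qed
  moreover have "(\<Sum>\<rho>\<in>mixed_vectors. \<Prod>j\<in>UNIV. ?c \<rho> j (m j)) = (2 * \<i>) ^ CARD('n)"
  proof -
    let ?\<sigma> = "\<chi> j. sgn (m j)"
    have "?\<sigma> \<in> mixed_vectors"
    proof -
      obtain p q where "m p > 0" "m q < 0" using m by blast
      then have "?\<sigma> $ q = -1" "?\<sigma> $ p = 1" by simp_all
      moreover have "?\<sigma> $ j \<in> {-1, 0, 1}" for j by (simp add: sgn_if)
      ultimately show ?thesis unfolding mixed_vectors_def by blast
    qed
    moreover have "(\<Prod>j\<in>UNIV. ?c \<rho> j (m j)) = (if \<rho> = ?\<sigma> then (2 * \<i>) ^ CARD('n) else 0)" for \<rho>
    proof (cases "\<rho> = ?\<sigma>")
      case False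
      then obtain j where "\<rho> $ j \<noteq> sgn (m j)" by (auto simp: vec_eq_iff)
      then have "(\<Prod>j\<in>UNIV. ?c \<rho> j (m j)) = 0"
        by (intro prod_zero) (auto intro!: bexI[of _ j] exI[of _ j])
      then show ?thesis using False by simp
    qed simp
    ultimately show ?thesis
      by (simp add: finite_mixed_vectors)
  qed
  ultimately show "moment \<mu> m = 0" by simp
qed

text \<open>
  The factors of the integrand of (d) in the disk picture, without the weights.
\<close>

definition mixed_deriv_kernel :: "'n \<Rightarrow> 'n \<Rightarrow> 'n \<Rightarrow> complex \<Rightarrow> complex \<Rightarrow> complex" where
  "mixed_deriv_kernel p q j \<zeta> u =
    (if j = p then deriv_kernel \<zeta> u else if j = q then cnj (deriv_kernel \<zeta> u) else poisson \<zeta> u)"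

lemma prod_split_two:
  fixes f :: "'n::finite \<Rightarrow> 'b::comm_monoid_mult"
  assumes "p \<noteq> q"
  shows "(\<Prod>j\<in>UNIV. f j) = f p * f q * (\<Prod>j\<in>UNIV - {p, q}. f j)"
proof -
  have "UNIV - {p} - {q} = UNIV - {p, q}" by auto
  then show ?thesis
    using assms by (simp add: prod.remove[of UNIV p] prod.remove[of "UNIV - {p}" q] mult.assoc)
qed

lemma cond_d_integrand_eq:
  assumes "\<And>j. Im (z $ j) > 0" "p \<noteq> q"
  shows "1 / ((of_real (t $ p) - z $ p) ^ 2 * (of_real (t $ q) - cnj (z $ q)) ^ 2)
          * (\<Prod>l\<in>UNIV - {p, q}. 1 / (of_real (t $ l) - z $ l) - 1 / (of_real (t $ l) - cnj (z $ l)))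
    = (\<Prod>j\<in>UNIV. mixed_deriv_kernel p q j (cayley (z $ j)) (unit_coord j t)) * weight t"
proof -
  let ?G = "\<lambda>j. mixed_deriv_kernel p q j (cayley (z $ j)) (unit_coord j t)
    * (1 / (1 + complex_of_real (t $ j) ^ 2))"
  have p: "1 / (of_real (t $ p) - z $ p) ^ 2 = ?G p"
    by (simp add: deriv_kernel_eq[OF assms(1)] mixed_deriv_kernel_def unit_coord_def)
  have "1 / (of_real (t $ q) - cnj (z $ q)) ^ 2 = cnj (1 / (of_real (t $ q) - z $ q) ^ 2)" by simp
  also have "\<dots> = ?G q"
    using assms(2) by (subst deriv_kernel_eq[OF assms(1)]) (simp add: mixed_deriv_kernel_def unit_coord_def)
  finally have q: "1 / (of_real (t $ q) - cnj (z $ q)) ^ 2 = ?G q" .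
  have l: "(\<Prod>l\<in>UNIV - {p, q}. 1 / (of_real (t $ l) - z $ l) - 1 / (of_real (t $ l) - cnj (z $ l))) =
      (\<Prod>l\<in>UNIV - {p, q}. ?G l)"
    by (intro prod.cong refl, subst poisson_eq[OF assms(1)]) (simp add: mixed_deriv_kernel_def unit_coord_def)
  have "1 / (a * b) = (1 / a) * (1 / b)" for a b :: complex by simp
  then show ?thesis
    unfolding weight_def prod.distrib[symmetric] prod_split_two[OF assms(2)] 
    by (simp only: p q l prod.distrib mult.assoc mult.commute mult.left_commute)
qed

text \<open>
  The factor at \<open>p = j\<^sub>1\<close> has only negative and the factor at \<open>q = j\<^sub>2\<close> only positive frequencies, so only
  mixed moments enter.
\<close>

lemma cond_c_imp_cond_d:
  fixes \<mu> :: "(real ^ ('n :: {finite, linorder})) measure"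
  assumes sets: "sets \<mu> = sets borel" and w: "integrable \<mu> weight"
    and c: "cond_c \<mu>"
  shows "cond_d \<mu>"
  unfolding cond_d_def
proof (intro allI impI)
  fix z :: "complex ^ ('n :: {finite, linorder})" and p q :: 'n
  assume z: "\<forall>j. z $ j \<in> upper_half_plane" and "p < q"
  then have pq: "p \<noteq> q" by simp
  have im: "Im (z $ j) > 0" for j using z by (simp add: upper_half_plane_def)
  define d where "d j k = (1 - cayley (z $ j))^2 *
    (if k < 0 then of_nat (nat (- k)) * cayley (z $ j) ^ (nat (- k) - 1) else 0)" for j k
  define c where "c j k = (if j = p then d j k else if j = q then cnj (d j (- k))
    else 2 * \<i> * disk_pow (cayley (z $ j)) k)" for j k
  have "(LINT t|\<mu>. (\<Prod>j\<in>UNIV. mixed_deriv_kernel p q j (cayley (z $ j)) (unit_coord j t)) * weight t) = 0"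
  proof (rule integral_zero_if_moments_zero[OF _ measurable_unit_coord[OF sets] norm_unit_coord w])
    fix j
    have d: "has_fourier (deriv_kernel (cayley (z $ j))) (d j)"
      using has_fourier_deriv_kernel[OF norm_cayley_less_1[OF im]] unfolding d_def .
    consider "j = p" | "j = q" "j \<noteq> p" | "j \<noteq> p" "j \<noteq> q" by blast
    then show "has_fourier (mixed_deriv_kernel p q j (cayley (z $ j))) (c j)"
    proof cases
      case 1
      show ?thesis by (rule has_fourier_cong[OF d]) (simp_all add: 1 mixed_deriv_kernel_def c_def)
    next
      case 2
      show ?thesis by (rule has_fourier_cong[OF has_fourier_cnj[OF d]])
          (use 2 in \<open>simp_all add: mixed_deriv_kernel_def c_def\<close>)
    next
      case 3
      show ?thesis by (rule has_fourier_cong[OF has_fourier_poisson[OF norm_cayley_less_1[OF im[of j]]]])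
          (use 3 in \<open>simp_all add: mixed_deriv_kernel_def c_def\<close>)
    qed
  next
    fix m :: "'n \<Rightarrow> int" assume nz: "\<And>j. c j (m j) \<noteq> 0"
    have "m p < 0" using nz[of p] by (auto simp: c_def d_def split: if_splits)
    moreover have "m q > 0" using nz[of q] pq by (auto simp: c_def d_def split: if_splits)
    ultimately show "(LINT t|\<mu>. (\<Prod>j\<in>UNIV. unit_coord j t powi m j) * weight t) = 0"
      using assms(3) unfolding cond_c_iff_moments moment_def by blast
  qed
  then show "(LINT t|\<mu>. 1 / ((of_real (t $ p) - z $ p) ^ 2 * (of_real (t $ q) - cnj (z $ q)) ^ 2)
          * (\<Prod>l\<in>UNIV - {p, q}. 1 / (of_real (t $ l) - z $ l) - 1 / (of_real (t $ l) - cnj (z $ l)))) = 0"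
    by (simp only: cond_d_integrand_eq[OF im pq])
qed

text \<open>
  For \<open>m p < 0 < m q\<close> with \<open>p < q\<close> the \<open>m\<close>-th moment occurs with a nonzero coefficient in the
  expansion for \<open>j\<^sub>1 = p\<close>, \<open>j\<^sub>2 = q\<close>. When \<open>q < p\<close>, the vector \<open>-m\<close> has this sign pattern, and
  its moment is the conjugate of the one for \<open>m\<close>.
\<close>

lemma cond_d_imp_cond_c:
  fixes \<mu> :: "(real ^ ('n :: {finite, linorder})) measure"
  assumes sets: "sets \<mu> = sets borel" and w: "integrable \<mu> weight"
    and d: "cond_d \<mu>"
  shows "cond_c \<mu>"
proof -
  have ordered: "moment \<mu> m = 0" if pq: "p < q" and m: "m p < 0" "m q > 0" for p q :: 'n and m
  proof -
    \<comment> \<open>The factor \<open>(1 - \<zeta>)\<^sup>2\<close> is divided out, and \<open>\<zeta>\<close> raises the exponents \<open>n - 1\<close> to \<open>n\<close>, so that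
      the coefficients become multiples of \<open>disk_pow \<zeta>\<close> that do not depend on \<open>\<zeta>\<close>.\<close>
    let ?s = "\<lambda>j \<zeta>. if j = p then \<zeta> / (1 - \<zeta>)^2 else if j = q then cnj (\<zeta> / (1 - \<zeta>)^2) else 1"
    let ?c = "\<lambda>j k. if j = p then (if k < 0 then of_int (- k) else 0)
      else if j = q then (if k > 0 then of_int k else 0) else 2 * \<i>"
    have "(\<Sum>\<rho>\<in>{()}. \<Prod>j\<in>UNIV. ?c j (m j)) * moment \<mu> m = 0"
      unfolding moment_def
    proof (rule fourier_coefficients_vanish[where F = "\<lambda>\<rho> j \<zeta> u. ?s j \<zeta> * mixed_deriv_kernel p q j \<zeta> u",
          OF _ measurable_unit_coord[OF sets] norm_unit_coord w])
      fix j \<zeta> assume \<zeta>: "norm (\<zeta> :: complex) < 1"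
      have 1: "1 - \<zeta> \<noteq> 0" using \<zeta> by auto
      have neg: "has_fourier (\<lambda>u. \<zeta> / (1 - \<zeta>)^2 * deriv_kernel \<zeta> u)
          (\<lambda>k. (if k < 0 then of_int (- k) else 0) * disk_pow \<zeta> k)"
      proof (rule has_fourier_cong[OF has_fourier_cmult[OF has_fourier_deriv_kernel[OF \<zeta>]]])
        fix k :: int
        show "\<zeta> / (1 - \<zeta>)^2 * ((1 - \<zeta>)^2 * (if k < 0 then of_nat (nat (- k)) * \<zeta> ^ (nat (- k) - 1) else 0)) =
            (if k < 0 then of_int (- k) else 0) * disk_pow \<zeta> k"
          using 1 by (auto simp: disk_pow_def power_eq_if)
      qed simp
      consider "j = p" | "j = q" "j \<noteq> p" | "j \<noteq> p" "j \<noteq> q" by blast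
      then show "has_fourier (\<lambda>u. ?s j \<zeta> * mixed_deriv_kernel p q j \<zeta> u) (\<lambda>k. ?c j k * disk_pow \<zeta> k)"
      proof cases
        case 1
        show ?thesis by (rule has_fourier_cong[OF neg]) (simp_all add: 1 mixed_deriv_kernel_def)
      next
        case 2
        show ?thesis by (rule has_fourier_cong[OF has_fourier_cnj[OF neg]])
            (use 2 in \<open>simp_all add: mixed_deriv_kernel_def cnj_disk_pow_minus\<close>)
      next
        case 3
        show ?thesis by (rule has_fourier_cong[OF has_fourier_poisson[OF \<zeta>]])
            (use 3 in \<open>simp_all add: mixed_deriv_kernel_def\<close>)
      qed
    next
      fix \<zeta> :: "'n \<Rightarrow> complex" assume \<zeta>: "\<And>j. norm (\<zeta> j) < 1"
      obtain z :: "complex ^ ('n :: {finite, linorder})" where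
        z: "\<forall>j. z $ j \<in> upper_half_plane" "\<forall>j. cayley (z $ j) = \<zeta> j"
        by (rule choose_in_half_plane[where \<zeta> = \<zeta>, OF \<zeta>])
      have im: "Im (z $ j) > 0" for j using z(1) by (simp add: upper_half_plane_def)
      have pq': "p \<noteq> q" using pq by simp
      have "(LINT t|\<mu>. (\<Prod>j\<in>UNIV. mixed_deriv_kernel p q j (\<zeta> j) (unit_coord j t)) * weight t) = 0"
        using d z(1) pq
        unfolding cond_d_def cond_d_integrand_eq[OF im pq', unfolded z(2)[rule_format], symmetric] by blast
      then show "(\<Sum>\<rho>\<in>{()}. LINT t|\<mu>.
          (\<Prod>j\<in>UNIV. ?s j (\<zeta> j) * mixed_deriv_kernel p q j (\<zeta> j) (unit_coord j t)) * weight t) = 0"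
        by (simp only: prod.distrib mult.assoc) simp
    qed
    moreover have "?c j (m j) \<noteq> 0" for j using m by auto
    ultimately show ?thesis by simp
  qed
  show ?thesis unfolding cond_c_iff_moments
  proof (intro allI impI)
    fix m :: "'n \<Rightarrow> int" assume "(\<exists>j. m j > 0) \<and> (\<exists>j. m j < 0)"
    then obtain p q where pq: "m p < 0" "m q > 0" by blast
    then consider "p < q" | "q < p" by (metis linorder_cases order_less_asym)
    then show "moment \<mu> m = 0"
    proof cases
      case 1
      then show ?thesis using pq by (rule ordered)
    next
      case 2
      then have "moment \<mu> (\<lambda>j. - m j) = 0" using pq by (intro ordered[of q p]) auto
      then show ?thesis by (simp add: moment_uminus)
    qed
  qed
qed

theorem theorem5p1:
  fixes \<mu> :: "(real^('n::{finite,linorder})) measure"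
  assumes "CARD('n) \<ge> 2"
    and "sets \<mu> = sets borel"
    and "(\<integral>\<^sup>+ t. ennreal (\<Prod>l\<in>UNIV. 1 / (1 + (t $ l)^2)) \<partial>\<mu>) < \<infinity>"
  shows "(cond_a \<mu> \<longleftrightarrow> cond_b \<mu>) \<and> (cond_b \<mu> \<longleftrightarrow> cond_c \<mu>) \<and> (cond_c \<mu> \<longleftrightarrow> cond_d \<mu>)"
proof -
  have w: "integrable \<mu> weight"
    using assms(2,3) by (rule integrable_weight)
  have "cond_b \<mu> \<Longrightarrow> cond_a \<mu>" by (simp add: cond_a_def cond_b_def)
  with cond_a_imp_cond_c[OF assms(2) w] cond_c_imp_cond_b[OF assms(2) w]
    cond_c_imp_cond_d[OF assms(2) w] cond_d_imp_cond_c[OF assms(2) w]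
  show ?thesis by blast
qed

end
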